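(* Let $N,K\ge 1$ be integers, $-\infty\le a<b\le\infty$, and let $\mathbf{f}_1,\dots,\mathbf{f}_K\in L^2(a,b;\mathbb{C}^{N\times N})$ be linearly independent matrix-valued signals. Let $\mathbf{g}_1,\dots,\mathbf{g}_K$ be constructed by the Gram-Schmidt procedure $$\mathbf{g}_1=\langle\mathbf{f}_1,\mathbf{f}_1\rangle^{-1/2}\mathbf{f}_1,$$ and, for $2\le k\le K$, $$\hat{\mathbf{g}}_k=\mathbf{f}_k-\sum_{l=1}^{k-1}\langle\mathbf{f}_k,\mathbf{g}_l\rangle\,\mathbf{g}_l,\qquad \mathbf{g}_k=\langle\hat{\mathbf{g}}_k,\hat{\mathbf{g}}_k\rangle^{-1/2}\,\hat{\mathbf{g}}_k.$$ Then $\mathbf{g}_1,\mathbf{g}_2,\dots,\mathbf{g}_K$ form an orthonormal set.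
   Context: $L^2(a,b;\mathbb{C}^{N\times N})$ is the set of matrix-valued signals $\mathbf{f}(t)=(f_{kl}(t))_{1\le k,l\le N}$ with every entry $f_{kl}\in L^2(a,b)$, complex-valued (signals equal almost everywhere are identified). Products such as $A\mathbf{f}$ with $A\in\mathbb{C}^{N\times N}$ are pointwise matrix products. The matrix-valued inner product is $\langle\mathbf{f},\mathbf{g}\rangle=\int_a^b\mathbf{f}(t)\mathbf{g}^{\dagger}(t)\,dt\in\mathbb{C}^{N\times N}$ (entrywise integral; $^{\dagger}$ is complex conjugate transpose). A signal $\mathbf{f}$ is degenerate if the matrix $\langle\mathbf{f},\mathbf{f}\rangle$ does not have full rank (is singular), and nondegenerate otherwise. Signals $\mathbf{f}_1,\dots,\mathbf{f}_K$ are called linearly independent if the following holds: whenever $F_1,\dots,F_K\in\mathbb{C}^{N\times N}$ are constant matrices such that $\mathbf{f}:=\sum_{k=1}^K F_k\mathbf{f}_k$ is degenerate, the null space of $F_k^{\dagger}$ includes the null space of $\langle\mathbf{f},\mathbf{f}\rangle$ for every $k=1,\dots,K$. For a positive definite Hermitian matrix $P$, $P^{-1/2}$ denotes the inverse of its positive definite square root. Signals $\mathbf{g}_1,\dots,\mathbf{g}_K$ form an orthonormal set if $\langle\mathbf{g}_k,\mathbf{g}_l\rangle=\delta(k-l)I_N$ for all $k,l$, where $\delta(0)=1$, $\delta(m)=0$ for $m\ne0$, and $I_N$ is the identity matrix. *)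

theory Defs
  imports "HOL-Analysis.Analysis"
begin

definition dagger :: "complex^'n^'m \<Rightarrow> complex^'m^'n" where
  "dagger A = (\<chi> i j. cnj (A $ j $ i))"

definition null_space :: "complex^'n^'m \<Rightarrow> (complex^'n) set" where
  "null_space A = {v. A *v v = 0}"

definition posdef :: "complex^'n^'n \<Rightarrow> bool" where
  "posdef P \<longleftrightarrow> dagger P = P \<and>
     (\<forall>v. v \<noteq> 0 \<longrightarrow> Re (\<Sum>i\<in>UNIV. cnj (v $ i) * (P *v v) $ i) > 0)"

(* Unspecified when P is not positive definite. *)
definition posdef_sqrt :: "complex^'n^'n \<Rightarrow> complex^'n^'n" where
  "posdef_sqrt P = (THE S. posdef S \<and> S ** S = P)"

definition inv_sqrt :: "complex^'n^'n \<Rightarrow> complex^'n^'n" where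
  "inv_sqrt P = matrix_inv (posdef_sqrt P)"

(* Signals are functions on the whole line, of which only the values on (a, b) matter.  Equality
   in L^2 is equality almost everywhere on (a, b). *)

definition L2_signals :: "ereal \<Rightarrow> ereal \<Rightarrow> (real \<Rightarrow> complex^'n^'n) set" where
  "L2_signals a b = {f. \<forall>i j.
     (\<lambda>t. f t $ i $ j) \<in> borel_measurable (lebesgue_on (einterval a b)) \<and>
     integrable (lebesgue_on (einterval a b)) (\<lambda>t. (cmod (f t $ i $ j))\<^sup>2)}"

definition mat_inner ::
  "ereal \<Rightarrow> ereal \<Rightarrow> (real \<Rightarrow> complex^'n^'n) \<Rightarrow> (real \<Rightarrow> complex^'n^'n) \<Rightarrow> complex^'n^'n" where
  "mat_inner a b f g =
     (\<chi> i j. integral\<^sup>L (lebesgue_on (einterval a b)) (\<lambda>t. (f t ** dagger (g t)) $ i $ j))"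

definition degenerate :: "ereal \<Rightarrow> ereal \<Rightarrow> (real \<Rightarrow> complex^'n^'n) \<Rightarrow> bool" where
  "degenerate a b f \<longleftrightarrow> rank (mat_inner a b f f) \<noteq> CARD('n)"

lemma degenerate_iff_singular: "degenerate a b f \<longleftrightarrow> \<not> invertible (mat_inner a b f f)"
proof -
  have "invertible M \<longleftrightarrow> rank M = CARD('a)" for M :: "complex^'a^'a"
  proof -
    have "invertible M \<longleftrightarrow> vec.span (rows M) = UNIV"
      by (simp add: invertible_left_inverse matrix_left_invertible_span_rows_gen)
    also have "\<dots> \<longleftrightarrow> vec.dim (rows M) = vec.dimension TYPE(complex) TYPE('a)"
      by (rule vec.dim_eq_full[symmetric])
    finally show ?thesis
      by (simp add: row_rank_def_gen vec.dimension_def card_cart_basis)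
  qed
  then show ?thesis
    by (simp add: degenerate_def)
qed

definition lin_indep_signals ::
  "ereal \<Rightarrow> ereal \<Rightarrow> nat \<Rightarrow> (nat \<Rightarrow> real \<Rightarrow> complex^'n^'n) \<Rightarrow> bool" where
  "lin_indep_signals a b K f \<longleftrightarrow>
     (\<forall>F :: nat \<Rightarrow> complex^'n^'n.
        let h = (\<lambda>t. \<Sum>k = 1..K. F k ** f k t) in
        degenerate a b h \<longrightarrow>
          (\<forall>k\<in>{1..K}. null_space (mat_inner a b h h) \<subseteq> null_space (dagger (F k))))"

definition orthonormal_signals ::
  "ereal \<Rightarrow> ereal \<Rightarrow> nat \<Rightarrow> (nat \<Rightarrow> real \<Rightarrow> complex^'n^'n) \<Rightarrow> bool" where
  "orthonormal_signals a b K g \<longleftrightarrow>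
     (\<forall>k\<in>{1..K}. \<forall>l\<in>{1..K}. mat_inner a b (g k) (g l) = (if k = l then mat 1 else 0))"

end

theory Submission
  imports Defs
begin

text \<open>Write each Gram-Schmidt signal as a combination \<open>\<Sum>j. F j ** f j\<close> of the given ones. Since
  \<open>g_hat k\<close> has the identity as its coefficient of \<open>f k\<close>, linear independence forces the null space of
  its Gram matrix into that of the identity, so the Gram matrix is invertible, hence positive
  definite, and \<open>inv_sqrt\<close> normalises it. Orthogonality to the earlier signals is the usual
  computation. The square root of a positive definite \<open>P\<close> is obtained from a fixed point of
  \<open>X \<mapsto> (A + X\<^sup>2) / 2\<close> with \<open>A = 1 - cP\<close> of operator norm less than 1, since such a fixed point
  satisfies \<open>(1 - X)\<^sup>2 = cP\<close>.\<close>

section \<open>Square roots of positive definite matrices\<close>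

lemma dagger_dagger [simp]: "dagger (dagger A) = A"
  by (simp add: dagger_def vec_eq_iff)

lemma dagger_mult: "dagger (A ** B) = dagger B ** dagger A"
  by (simp add: dagger_def matrix_matrix_mult_def vec_eq_iff mult.commute)

lemma dagger_mat_1 [simp]: "dagger (mat 1) = mat 1"
  by (simp add: dagger_def mat_def vec_eq_iff)

lemma inner_mult_complex: "(a * b) \<bullet> c = b \<bullet> (cnj a * c)" for a b c :: complex
  by (simp add: inner_complex_def algebra_simps)

text \<open>The real inner product \<open>\<bullet>\<close> of complex vectors is the real part of the Hermitian one, so
  \<open>dagger\<close> is also the adjoint for \<open>\<bullet>\<close>.\<close>

lemma inner_matrix_vector_left: "(A *v v) \<bullet> w = v \<bullet> (dagger A *v w)"
  for A :: "complex^'n^'m"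
proof -
  have "(A *v v) \<bullet> w = (\<Sum>i\<in>UNIV. \<Sum>j\<in>UNIV. (A $ i $ j * v $ j) \<bullet> (w $ i))"
    by (simp add: inner_vec_def matrix_vector_mult_def inner_sum_left)
  also have "\<dots> = (\<Sum>j\<in>UNIV. \<Sum>i\<in>UNIV. (v $ j) \<bullet> (cnj (A $ i $ j) * w $ i))"
    by (subst sum.swap) (simp add: inner_mult_complex)
  also have "\<dots> = v \<bullet> (dagger A *v w)"
    by (simp add: inner_vec_def matrix_vector_mult_def inner_sum_right dagger_def)
  finally show ?thesis .
qed

text \<open>Vectors are determined by their products \<open>\<bullet>\<close> with all others, so
  symmetry for the real inner product suffices. In this form the Hermitian property makes sense for
  operators that are not yet known to come from a matrix.\<close>

lemma dagger_eq_iff_self_adjoint: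
  "dagger A = A \<longleftrightarrow> (\<forall>v w. (A *v v) \<bullet> w = v \<bullet> (A *v w))"
  for A :: "complex^'n^'n"
proof
  assume *: "\<forall>v w. (A *v v) \<bullet> w = v \<bullet> (A *v w)"
  have "dagger A *v w = A *v w" for w
  proof -
    have "v \<bullet> (dagger A *v w) = v \<bullet> (A *v w)" for v
      using * inner_matrix_vector_left[of A v w] by simp
    then show ?thesis
      using vector_eq_rdot[of "dagger A *v w" "A *v w"] by (simp add: inner_commute)
  qed
  then show "dagger A = A"
    by (simp add: matrix_eq)
qed (metis inner_matrix_vector_left)

lemma posdef_iff: "posdef P \<longleftrightarrow> dagger P = P \<and> (\<forall>v. v \<noteq> 0 \<longrightarrow> 0 < v \<bullet> (P *v v))"
proof -
  have "Re (\<Sum>i\<in>UNIV. cnj (v $ i) * (P *v v) $ i) = v \<bullet> (P *v v)" for v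
    by (simp add: inner_vec_def inner_complex_def)
  then show ?thesis
    by (simp add: posdef_def)
qed

lemma posdef_invertible:
  assumes "posdef P" shows "invertible P"
proof -
  have "v = 0" if "P *v v = 0" for v
    using assms that by (metis inner_zero_right less_irrefl posdef_iff)
  then show ?thesis
    by (simp add: invertible_left_inverse matrix_left_invertible_ker)
qed

lemma matrix_vector_scaleR:
  fixes A :: "'a::real_algebra_1^'n^'m"
  shows "(c *\<^sub>R A) *v v = c *\<^sub>R (A *v v)" "A *v (c *\<^sub>R v) = c *\<^sub>R (A *v v)"
  by (simp_all add: matrix_vector_mult_def vec_eq_iff scaleR_sum_right)

lemma posdef_scaleR:
  assumes "posdef P" "c > 0" shows "posdef (c *\<^sub>R P)"
proof -
  have "dagger (c *\<^sub>R P) = c *\<^sub>R P"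
    using assms unfolding posdef_iff by (simp add: dagger_def vec_eq_iff)
  then show ?thesis
    using assms by (simp add: posdef_iff matrix_vector_scaleR)
qed

section \<open>Uniqueness of the positive definite square root\<close>

text \<open>A diagonal entry is \<open>axis i 1 \<bullet> (X *v (S *v (X *v axis i 1)))\<close>, and
  the self-adjoint \<open>X\<close> moves to the left factor. For positive definite \<open>S\<close>
  every summand is then nonnegative.\<close>

lemma trace_sandwich:
  fixes X S :: "complex^'n^'n"
  assumes "dagger X = X"
  shows "Re (trace (X ** S ** X)) = (\<Sum>i\<in>UNIV. column i X \<bullet> (S *v column i X))"
proof -
  have "Re ((X ** S ** X) $ i $ i) = column i X \<bullet> (S *v column i X)" for i
  proof -
    have basis: "A *v axis i 1 = column i A" for A :: "complex^'n^'n"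
      by (simp add: matrix_vector_mult_def column_def axis_def vec_eq_iff if_distrib cong: if_cong)
    have "Re (A $ i $ i) = axis i 1 \<bullet> (A *v axis i 1)" for A :: "complex^'n^'n"
      unfolding basis by (simp add: inner_axis' column_def inner_complex_def)
    then have "Re ((X ** S ** X) $ i $ i) = axis i 1 \<bullet> (X *v (S *v (X *v axis i 1)))"
      by (simp add: matrix_vector_mul_assoc matrix_mul_assoc)
    also have "\<dots> = (X *v axis i 1) \<bullet> (S *v (X *v axis i 1))"
      using assms by (simp add: inner_matrix_vector_left)
    finally show ?thesis
      by (simp add: basis)
  qed
  then show ?thesis
    by (simp add: trace_def)
qed

text \<open>The difference \<open>X = S - T\<close> satisfies \<open>S ** X + X ** T = 0\<close>.
  Multiplying by \<open>X\<close> on the left, taking traces and using their cyclicity gives two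
  nonnegative numbers with sum 0. So both vanish, and positivity of \<open>S\<close> kills every
  column of \<open>X\<close>.\<close>

lemma posdef_sqrt_unique:
  fixes S T :: "complex^'n^'n"
  assumes S: "posdef S" and T: "posdef T" and eq: "S ** S = T ** T"
  shows "S = T"
proof -
  define X where "X = S - T"
  have X: "dagger X = X"
    using S T unfolding posdef_iff X_def by (simp add: dagger_def vec_eq_iff)
  have nonneg: "0 \<le> column i X \<bullet> (R *v column i X)" if "posdef R" for R i
    using that by (cases "column i X = 0") (auto simp: posdef_iff less_imp_le)
  have sylv: "S ** X + X ** T = 0"
    using eq unfolding X_def
    by (simp add: vec_eq_iff matrix_matrix_mult_def sum_subtractf algebra_simps flip: sum.distrib)
  have "trace (X ** S ** X) + trace (X ** T ** X) = trace (X ** S ** X) + trace (X ** X ** T)"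
    using trace_mul_sym[of "X ** T" X] by (simp add: matrix_mul_assoc)
  also have "\<dots> = trace (X ** (S ** X + X ** T))"
    by (simp add: trace_add matrix_add_ldistrib matrix_mul_assoc)
  also have "\<dots> = 0"
    unfolding sylv by (simp add: trace_def matrix_matrix_mult_def)
  finally have "Re (trace (X ** S ** X)) + Re (trace (X ** T ** X)) = 0"
    by (metis plus_complex.sel(1) zero_complex.sel(1))
  moreover have "0 \<le> Re (trace (X ** R ** X))" if "posdef R" for R
    using nonneg[OF that] by (simp add: trace_sandwich[OF X] sum_nonneg)
  ultimately have "Re (trace (X ** S ** X)) = 0"
    using S T by (simp add: add_nonneg_eq_0_iff)
  then have "(\<Sum>i\<in>UNIV. column i X \<bullet> (S *v column i X)) = 0"
    by (simp add: trace_sandwich[OF X])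
  then have "column i X \<bullet> (S *v column i X) = 0" for i
    using nonneg[OF S] by (simp add: sum_nonneg_eq_0_iff)
  then have "column i X = 0" for i
    using S by (metis less_irrefl posdef_iff)
  then have "X = 0"
    by (simp add: vec_eq_iff column_def)
  then show ?thesis
    by (simp add: X_def)
qed

section \<open>Existence of the positive definite square root\<close>

text \<open>On the ball of radius \<open>r\<close> the map is a contraction with constant
  \<open>r\<close>, and it preserves the ball because \<open>(r + r * r) / 2 \<le> r\<close>. The
  closed set \<open>C\<close> carries over to the fixed point any further property that the map
  preserves.\<close>

lemma blinfun_quadratic_fixed_point:
  fixes A :: "'a::banach \<Rightarrow>\<^sub>L 'a"
  assumes C: "closed C" "0 \<in> C" and norm: "norm A \<le> r" "r < 1"
    and inv: "\<And>X. X \<in> C \<Longrightarrow> (1/2) *\<^sub>R (A + (X o\<^sub>L X)) \<in> C"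
  shows "\<exists>X\<in>C. norm X \<le> r \<and> X = (1/2) *\<^sub>R (A + (X o\<^sub>L X))"
proof -
  define F where "F X = (1/2) *\<^sub>R (A + (X o\<^sub>L X))" for X
  have r: "0 \<le> r"
    using norm(1) norm_ge_zero order_trans by blast
  have comp: "norm (X o\<^sub>L Y) \<le> r * norm Y" if "norm X \<le> r" for X Y :: "'a \<Rightarrow>\<^sub>L 'a"
    using norm_blinfun_compose[of X Y] mult_right_mono[OF that norm_ge_zero[of Y]] by linarith
  have comp': "norm (Y o\<^sub>L X) \<le> r * norm Y" if "norm X \<le> r" for X Y :: "'a \<Rightarrow>\<^sub>L 'a"
    using norm_blinfun_compose[of Y X] mult_right_mono[OF that norm_ge_zero[of Y]]
    by (simp add: mult.commute)
  have "\<exists>!X. X \<in> C \<inter> cball 0 r \<and> F X = X"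
  proof (rule Banach_fix)
    show "complete (C \<inter> cball 0 r)"
      by (simp add: C closed_Int complete_eq_closed)
    show "C \<inter> cball 0 r \<noteq> {}"
      using C r by force
    show "F ` (C \<inter> cball 0 r) \<subseteq> C \<inter> cball 0 r"
    proof
      fix Y assume "Y \<in> F ` (C \<inter> cball 0 r)"
      then obtain X where X: "X \<in> C" "norm X \<le> r" "Y = F X"
        by auto
      have "norm (X o\<^sub>L X) \<le> r * r"
        using comp[OF X(2), of X] mult_left_mono[OF X(2) r] by linarith
      also have "\<dots> \<le> r"
        using r norm(2) by (simp add: mult_left_le)
      finally have "norm (A + (X o\<^sub>L X)) \<le> 2 * r"
        using norm(1) norm_triangle_ineq[of A "X o\<^sub>L X"] by linarith
      then show "Y \<in> C \<inter> cball 0 r"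
        using X inv by (simp add: F_def)
    qed
    show "dist (F X) (F Y) \<le> r * dist X Y"
      if "X \<in> C \<inter> cball 0 r" "Y \<in> C \<inter> cball 0 r" for X Y
    proof -
      have XY: "norm X \<le> r" "norm Y \<le> r"
        using that by auto
      \<comment> \<open>Difference of two squares for operators that need not commute.\<close>
      have "F X - F Y = (1/2) *\<^sub>R ((X o\<^sub>L (X - Y)) + ((X - Y) o\<^sub>L Y))"
        by (rule blinfun_eqI) (simp add: F_def blinfun.bilinear_simps algebra_simps)
      then have "2 * norm (F X - F Y) = norm ((X o\<^sub>L (X - Y)) + ((X - Y) o\<^sub>L Y))"
        by simp
      also have "\<dots> \<le> r * norm (X - Y) + r * norm (X - Y)"
        using comp[OF XY(1), of "X - Y"] comp'[OF XY(2), of "X - Y"]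
        by (intro norm_triangle_le add_mono)
      finally show ?thesis
        by (simp add: dist_norm)
    qed
  qed (use r norm in auto)
  then obtain X where "X \<in> C" "norm X \<le> r" "F X = X"
    by auto
  then show ?thesis
    unfolding F_def by metis
qed

text \<open>The quadratic form attains a positive minimum on the compact unit sphere; homogeneity of
  degree 2 extends the bound to all vectors.\<close>

lemma posdef_lower_bound:
  assumes "posdef P"
  shows "\<exists>m>0. \<forall>v. m * (norm v)\<^sup>2 \<le> v \<bullet> (P *v v)"
proof -
  have "continuous_on (sphere 0 1) (\<lambda>v. v \<bullet> (P *v v))"
    by (intro continuous_intros linear_continuous_on) simp
  moreover have ne: "sphere 0 1 \<noteq> ({} :: (complex^'a) set)"
    by simp
  ultimately obtain u where u: "u \<in> sphere 0 1"
    and le: "\<And>v. v \<in> sphere 0 1 \<Longrightarrow> u \<bullet> (P *v u) \<le> v \<bullet> (P *v v)"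
    using continuous_attains_inf[OF compact_sphere, of 0 1 "\<lambda>v. v \<bullet> (P *v v)"] by blast
  show ?thesis
  proof (intro exI[of _ "u \<bullet> (P *v u)"] conjI allI)
    show "0 < u \<bullet> (P *v u)"
    proof -
      have "u \<noteq> 0"
        using u by auto
      then show ?thesis
        using assms by (simp add: posdef_iff)
    qed
    show "u \<bullet> (P *v u) * (norm v)\<^sup>2 \<le> v \<bullet> (P *v v)" for v
    proof (cases "v = 0")
      case False
      have "u \<bullet> (P *v u) \<le> (v /\<^sub>R norm v) \<bullet> (P *v (v /\<^sub>R norm v))"
        using False by (intro le) simp
      also have "\<dots> = (v \<bullet> (P *v v)) / (norm v)\<^sup>2"
        by (simp add: matrix_vector_scaleR power2_eq_square divide_inverse)
      finally show ?thesis
        using False by (simp add: pos_le_divide_eq)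
    qed simp
  qed
qed

lemma posdef_sqrt_exists:
  fixes P :: "complex^'n^'n"
  assumes P: "posdef P"
  shows "\<exists>S. posdef S \<and> S ** S = P"
proof -
  obtain m where m: "0 < m" "\<And>v. m * (norm v)\<^sup>2 \<le> v \<bullet> (P *v v)"
    using posdef_lower_bound[OF P] by auto
  obtain B0 where B0: "0 < B0" "\<And>v. norm (P *v v) \<le> norm v * B0"
    using bounded_linear.pos_bounded[of "(*v) P"] by auto
  \<comment> \<open>Adding \<open>m\<close> keeps \<open>B\<close> an operator bound and ensures
    \<open>m \<le> B\<close>, so that the square root defining \<open>r\<close> has a nonnegative
    argument.\<close>
  define B where "B = B0 + m"
  have B: "0 < B" "m \<le> B" "norm (P *v v) \<le> B * norm v" for v
  proof -
    show "norm (P *v v) \<le> B * norm v"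
      using B0(2)[of v] mult_nonneg_nonneg[OF less_imp_le[OF m(1)] norm_ge_zero[of v]]
      by (simp add: B_def algebra_simps)
  qed (use B0(1) m(1) in \<open>auto simp: B_def\<close>)
  \<comment> \<open>This \<open>c\<close> minimises
    \<open>1 - 2 * c * m + c\<^sup>2 * B\<^sup>2\<close>, which bounds the squared norm of
    \<open>1 - cP\<close>. The minimum is \<open>r\<^sup>2\<close>.\<close>
  define c where "c = m / B\<^sup>2"
  define r where "r = sqrt (1 - (m / B)\<^sup>2)"
  have c: "0 < c"
    using m(1) B(1) by (simp add: c_def)
  have mB: "0 < m / B" "m / B \<le> 1"
    using m(1) B by auto
  have r: "0 \<le> r" "r < 1" "r\<^sup>2 = 1 - (m / B)\<^sup>2"
  proof -
    have "(m / B)\<^sup>2 \<le> 1"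
      using mB by (simp add: power_le_one)
    then show "0 \<le> r" "r\<^sup>2 = 1 - (m / B)\<^sup>2"
      by (auto simp: r_def)
    have "sqrt (1 - (m / B)\<^sup>2) < sqrt 1"
      using mB by (intro real_sqrt_less_mono) auto
    then show "r < 1"
      by (simp add: r_def)
  qed
  define A where "A = Blinfun (\<lambda>v. v - c *\<^sub>R (P *v v))"
  have A [simp]: "blinfun_apply A v = v - c *\<^sub>R (P *v v)" for v
    unfolding A_def
    by (subst bounded_linear_Blinfun_apply)
      (auto intro!: bounded_linear_sub bounded_linear_ident
        bounded_linear_compose[OF bounded_linear_scaleR_right])
  have "norm A \<le> r"
  proof (rule norm_blinfun_bound[OF r(1)])
    fix v
    have "(norm (blinfun_apply A v))\<^sup>2
        = (norm v)\<^sup>2 - 2 * c * (v \<bullet> (P *v v)) + c\<^sup>2 * (norm (P *v v))\<^sup>2"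
      unfolding power2_norm_eq_inner
      by (simp add: inner_diff_left inner_diff_right inner_commute power2_eq_square algebra_simps)
    also have "\<dots> \<le> (norm v)\<^sup>2 - 2 * c * (m * (norm v)\<^sup>2) + c\<^sup>2 * (B * norm v)\<^sup>2"
      using m(2)[of v] B(3)[of v] c
      by (intro add_mono diff_left_mono mult_left_mono power_mono) auto
    also have "\<dots> = (r * norm v)\<^sup>2"
      unfolding power_mult_distrib r(3) c_def
      using B(1) by (simp add: field_simps power2_eq_square)
    finally show "norm (blinfun_apply A v) \<le> r * norm v"
      using r(1) by (auto intro: power2_le_imp_le)
  qed
  \<comment> \<open>Operators of type \<open>\<Rightarrow>\<^sub>L\<close> are only real-linear. The
    second condition adds complex linearity, without which the fixed point could not be read as a
    complex matrix; the first one makes that matrix Hermitian.\<close>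
  define C :: "((complex^'n) \<Rightarrow>\<^sub>L (complex^'n)) set" where
    "C = {X. (\<forall>v w. blinfun_apply X v \<bullet> w = v \<bullet> blinfun_apply X w)
      \<and> (\<forall>z v. blinfun_apply X (z *s v) = z *s blinfun_apply X v)}"
  have bl: "bounded_linear (\<lambda>v :: complex^'n. z *s v)" for z :: complex
    using linear_conv_bounded_linear[of "\<lambda>v :: complex^'n. z *s v"]
    by (simp add: linear_iff vec_eq_iff algebra_simps)
  have "\<exists>X\<in>C. norm X \<le> r \<and> X = (1/2) *\<^sub>R (A + (X o\<^sub>L X))"
  proof (rule blinfun_quadratic_fixed_point)
    show "closed C"
      unfolding C_def
      by (intro closed_Collect_conj closed_Collect_all closed_Collect_eq continuous_intros
          bounded_linear.continuous_on[OF bl])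
    show "0 \<in> C"
      by (simp add: C_def vec_eq_iff)
    show "(1/2) *\<^sub>R (A + (X o\<^sub>L X)) \<in> C" if "X \<in> C" for X
    proof -
      have "(P *v v) \<bullet> w = v \<bullet> (P *v w)" for v w
        using P dagger_eq_iff_self_adjoint[of P] by (simp add: posdef_iff)
      then have "blinfun_apply ((1/2) *\<^sub>R (A + (X o\<^sub>L X))) v \<bullet> w
          = v \<bullet> blinfun_apply ((1/2) *\<^sub>R (A + (X o\<^sub>L X))) w" for v w
        using that by (simp add: C_def blinfun.bilinear_simps inner_add_left inner_add_right
            inner_diff_left inner_diff_right)
      moreover have "P *v (z *s v) = z *s (P *v v)" for z v
        by (rule vec.linear_scale[OF matrix_vector_mul_linear_gen])
      then have "blinfun_apply ((1/2) *\<^sub>R (A + (X o\<^sub>L X))) (z *s v)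
          = z *s blinfun_apply ((1/2) *\<^sub>R (A + (X o\<^sub>L X))) v" for z v
        using that by (simp add: C_def blinfun.bilinear_simps)
          (simp add: vec_eq_iff algebra_simps)
      ultimately show ?thesis
        unfolding C_def by blast
    qed
  qed (fact \<open>norm A \<le> r\<close> r(2))+
  then obtain X where X: "X \<in> C" "norm X \<le> r" "X = (1/2) *\<^sub>R (A + (X o\<^sub>L X))"
    by blast
  define S where "S = mat 1 - matrix (blinfun_apply X)"
  have "Vector_Spaces.linear (*s) (*s) (blinfun_apply X)"
    using X(1) by unfold_locales (auto simp: C_def blinfun.bilinear_simps)
  then have S: "S *v v = v - X v" for v
    by (simp add: S_def matrix_vector_mult_diff_rdistrib matrix_works)
  have "posdef S"
  proof -
    have "dagger S = S"
      using X(1) by (simp add: dagger_eq_iff_self_adjoint S C_def inner_diff_left inner_diff_right)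
    moreover have "0 < v \<bullet> (S *v v)" if "v \<noteq> 0" for v
    proof -
      \<comment> \<open>Since \<open>norm X \<le> r < 1\<close>, subtracting \<open>X\<close> from
        the identity leaves a strictly positive form.\<close>
      have "v \<bullet> X v \<le> norm v * (r * norm v)"
        using norm_cauchy_schwarz[of v "X v"] norm_blinfun[of X v] X(2)
        by (meson mult_left_mono mult_right_mono norm_ge_zero order_trans)
      also have "\<dots> < norm v * norm v"
        using that r by simp
      finally show ?thesis
        by (simp add: S inner_diff_right power2_norm_eq_inner flip: power2_eq_square)
    qed
    ultimately show ?thesis
      by (simp add: posdef_iff)
  qed
  have "S ** S = c *\<^sub>R P"
  proof -
    have "(S ** S) *v v = (c *\<^sub>R P) *v v" for v
    proof -
      \<comment> \<open>The fixed point equation says \<open>2X = A + X\<^sup>2\<close>, hence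
        \<open>(1 - X)\<^sup>2 = 1 - A = cP\<close>.\<close>
      have "X v = (1/2) *\<^sub>R (v - c *\<^sub>R (P *v v) + X (X v))"
        using arg_cong[OF X(3), of "\<lambda>Y. blinfun_apply Y v"] by (simp add: blinfun.bilinear_simps)
      then have "2 *\<^sub>R X v = v - c *\<^sub>R (P *v v) + X (X v)"
        by (metis (no_types) divide_self_if scaleR_one scaleR_scaleR
            times_divide_eq_right mult.right_neutral zero_neq_numeral)
      then have "v - X v - (X v - X (X v)) = c *\<^sub>R (P *v v)"
        by (simp add: scaleR_2 algebra_simps)
      then show ?thesis
        by (simp add: S blinfun.bilinear_simps flip: matrix_vector_mul_assoc) (simp add: matrix_vector_scaleR)
    qed
    then show ?thesis
      by (simp add: matrix_eq)
  qed
  let ?T = "(1 / sqrt c) *\<^sub>R S"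
  have "?T ** ?T = ((1 / sqrt c) * (1 / sqrt c)) *\<^sub>R (S ** S)"
    by (simp add: matrix_scalar_ac flip: scalar_matrix_assoc)
  also have "\<dots> = P"
    using c by (simp add: \<open>S ** S = c *\<^sub>R P\<close>)
  finally show ?thesis
    using posdef_scaleR[OF \<open>posdef S\<close>, of "1 / sqrt c"] c by auto
qed

text \<open>For the root \<open>S\<close> and its inverse \<open>Q\<close>, the adjoint of
  \<open>Q ** S = mat 1\<close> is \<open>S ** dagger Q = mat 1\<close>, so both factors of
  \<open>P = S ** S\<close> cancel. The left-hand side is the Gram matrix of a signal multiplied by
  \<open>Q\<close> when \<open>P\<close> is the Gram matrix of that signal.\<close>

lemma inv_sqrt_posdef:
  assumes "posdef P"
  shows "inv_sqrt P ** P ** dagger (inv_sqrt P) = mat 1"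
proof -
  define S where "S = posdef_sqrt P"
  define Q where "Q = inv_sqrt P"
  \<comment> \<open>Existence and uniqueness together give meaning to the \<open>THE\<close> in
    \<open>posdef_sqrt\<close>.\<close>
  have "\<exists>!S. posdef S \<and> S ** S = P"
    using posdef_sqrt_exists[OF assms] posdef_sqrt_unique by metis
  from theI'[OF this] have S: "posdef S" "S ** S = P"
    by (auto simp: S_def posdef_sqrt_def)
  have "S ** Q = mat 1 \<and> Q ** S = mat 1"
    using posdef_invertible[OF S(1)] unfolding invertible_def Q_def inv_sqrt_def S_def matrix_inv_def
    by (rule someI_ex)
  then have SQ: "S ** Q = mat 1" "Q ** S = mat 1"
    by auto
  have "S ** dagger Q = mat 1"
    using arg_cong[OF SQ(2), of dagger] S(1) by (simp add: dagger_mult posdef_iff)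
  then show "inv_sqrt P ** P ** dagger (inv_sqrt P) = mat 1"
    using SQ S(2) by (metis Q_def matrix_mul_assoc matrix_mul_rid)
qed

section \<open>The matrix-valued inner product\<close>

text \<open>These maps can be exchanged with the Bochner integral. Real linearity is enough for
  that, so the conjugate-linear \<open>dagger\<close> is covered as well.\<close>

lemma
  fixes A :: "complex^'n^'m"
  shows bounded_linear_matrix_mult_left: "bounded_linear (\<lambda>X :: complex^'k^'n. A ** X)"
    and bounded_linear_matrix_mult_right: "bounded_linear (\<lambda>Y :: complex^'m^'l. Y ** A)"
    and bounded_linear_matrix_vector_mult: "bounded_linear (\<lambda>Y :: complex^'m^'l. Y *v w)"
    and bounded_linear_dagger: "bounded_linear (dagger :: complex^'n^'m \<Rightarrow> _)"
proof -
  have "linear (\<lambda>X :: complex^'k^'n. A ** X)" "linear (\<lambda>Y :: complex^'m^'l. Y ** A)"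
    "linear (\<lambda>Y :: complex^'m^'l. Y *v w)" "linear (dagger :: complex^'n^'m \<Rightarrow> _)"
    by (auto simp: linear_iff vec_eq_iff dagger_def matrix_matrix_mult_def matrix_vector_mult_def
        scaleR_sum_right sum.distrib algebra_simps)
  then show "bounded_linear (\<lambda>X :: complex^'k^'n. A ** X)"
    "bounded_linear (\<lambda>Y :: complex^'m^'l. Y ** A)"
    "bounded_linear (\<lambda>Y :: complex^'m^'l. Y *v w)"
    "bounded_linear (dagger :: complex^'n^'m \<Rightarrow> _)"
    by (simp_all add: linear_conv_bounded_linear)
qed

lemma matrix_mult_sum_right: "A ** (\<Sum>i\<in>I. B i) = (\<Sum>i\<in>I. A ** B i)"
  for A :: "complex^'n^'m"
  by (rule linear_sum[OF bounded_linear.linear[OF bounded_linear_matrix_mult_left]])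

lemma matrix_mult_sum_left: "(\<Sum>i\<in>I. B i) ** A = (\<Sum>i\<in>I. B i ** A)"
  for A :: "complex^'n^'m"
  by (rule linear_sum[OF bounded_linear.linear[OF bounded_linear_matrix_mult_right]])

lemma matrix_mult_diff_left: "(B - C) ** A = B ** A - C ** A"
  for A :: "complex^'n^'m"
  by (rule linear_diff[OF bounded_linear.linear[OF bounded_linear_matrix_mult_right]])

section \<open>Square integrability and closure properties of signals\<close>

text \<open>Extension by zero outside \<open>S\<close> reduces this to the completeness of Lebesgue
  measure. It serves signals that are specified only almost everywhere, whose measurability has to
  be derived.\<close>

lemma borel_measurable_lebesgue_on_AE:
  fixes f :: "'a::euclidean_space \<Rightarrow> 'b::euclidean_space"
  assumes "f \<in> borel_measurable (lebesgue_on S)" "S \<in> sets lebesgue"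
    and "AE x in lebesgue_on S. f x = g x"
  shows "g \<in> borel_measurable (lebesgue_on S)"
proof -
  have "(\<lambda>x. if x \<in> S then f x else 0) \<in> borel_measurable lebesgue"
    using assms by (simp add: borel_measurable_if)
  moreover have "AE x in lebesgue. (if x \<in> S then f x else 0) = (if x \<in> S then g x else 0)"
  proof -
    have "AE x in lebesgue. x \<in> S \<longrightarrow> f x = g x"
      using assms by (simp add: AE_restrict_space_iff)
    then show ?thesis
      by eventually_elim auto
  qed
  ultimately have "(\<lambda>x. if x \<in> S then g x else 0) \<in> borel_measurable lebesgue"
    by (rule borel_measurable_AE)
  then show ?thesis
    using assms(2) by (simp add: borel_measurable_if)
qed

text \<open>Cauchy-Schwarz bounds the squared sum by \<open>card I\<close> times the sum of the
  squares.\<close>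

lemma square_integrable_sum:
  fixes u :: "'i \<Rightarrow> 'a \<Rightarrow> complex"
  assumes "\<And>i. i \<in> I \<Longrightarrow> u i \<in> borel_measurable M"
    and "\<And>i. i \<in> I \<Longrightarrow> integrable M (\<lambda>t. (cmod (u i t))\<^sup>2)"
  shows "integrable M (\<lambda>t. (cmod (\<Sum>i\<in>I. u i t))\<^sup>2)"
proof (rule Bochner_Integration.integrable_bound)
  show "integrable M (\<lambda>t. real (card I) * (\<Sum>i\<in>I. (cmod (u i t))\<^sup>2))"
    using assms(2) by (intro integrable_mult_right Bochner_Integration.integrable_sum)
  show "(\<lambda>t. (cmod (\<Sum>i\<in>I. u i t))\<^sup>2) \<in> borel_measurable M"
    using assms(1) by measurable
  show "AE t in M. norm ((cmod (\<Sum>i\<in>I. u i t))\<^sup>2)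
      \<le> norm (real (card I) * (\<Sum>i\<in>I. (cmod (u i t))\<^sup>2))"
  proof (rule AE_I2)
    fix t
    have "(cmod (\<Sum>i\<in>I. u i t))\<^sup>2 \<le> (\<Sum>i\<in>I. cmod (u i t))\<^sup>2"
      by (intro power_mono norm_sum) simp
    also have "\<dots> \<le> real (card I) * (\<Sum>i\<in>I. (cmod (u i t))\<^sup>2)"
      using sum_squared_le_sum_of_squares[of "\<lambda>i. cmod (u i t)" I] by (simp add: mult.commute)
    finally show "norm ((cmod (\<Sum>i\<in>I. u i t))\<^sup>2)
        \<le> norm (real (card I) * (\<Sum>i\<in>I. (cmod (u i t))\<^sup>2))"
      by simp
  qed
qed

lemma integrable_mult_of_square_integrable:
  fixes u v :: "'a \<Rightarrow> complex"
  assumes [measurable]: "u \<in> borel_measurable M" "v \<in> borel_measurable M"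
    and "integrable M (\<lambda>t. (cmod (u t))\<^sup>2)" "integrable M (\<lambda>t. (cmod (v t))\<^sup>2)"
  shows "integrable M (\<lambda>t. u t * v t)"
proof (rule Bochner_Integration.integrable_bound)
  show "integrable M (\<lambda>t. (cmod (u t))\<^sup>2 + (cmod (v t))\<^sup>2)"
    using assms by simp
  show "AE t in M. norm (u t * v t) \<le> norm ((cmod (u t))\<^sup>2 + (cmod (v t))\<^sup>2)"
  proof (rule AE_I2)
    fix t
    have "0 \<le> cmod (u t) * cmod (v t)"
      by simp
    then have "cmod (u t) * cmod (v t) \<le> (cmod (u t))\<^sup>2 + (cmod (v t))\<^sup>2"
      using sum_squares_bound[of "cmod (u t)" "cmod (v t)"] by linarith
    then show "norm (u t * v t) \<le> norm ((cmod (u t))\<^sup>2 + (cmod (v t))\<^sup>2)"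
      by (simp add: norm_mult)
  qed
qed measurable

lemma L2_signals_mult:
  assumes "f \<in> L2_signals a b"
  shows "(\<lambda>t. A ** f t) \<in> L2_signals a b"
proof -
  let ?M = "lebesgue_on (einterval a b)"
  have [measurable]: "(\<lambda>t. f t $ k $ j) \<in> borel_measurable ?M" for k j
    using assms by (simp add: L2_signals_def)
  have "integrable ?M (\<lambda>t. (cmod (A $ i $ k * f t $ k $ j))\<^sup>2)" for i j k
    using assms by (simp add: L2_signals_def norm_mult power_mult_distrib)
  then have "integrable ?M (\<lambda>t. (cmod (\<Sum>k\<in>UNIV. A $ i $ k * f t $ k $ j))\<^sup>2)" for i j
    by (intro square_integrable_sum) auto
  then show ?thesis
    by (simp add: L2_signals_def matrix_matrix_mult_def)
qed

lemma L2_signals_sum: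
  assumes "\<And>l. l \<in> I \<Longrightarrow> f l \<in> L2_signals a b"
  shows "(\<lambda>t. \<Sum>l\<in>I. f l t) \<in> L2_signals a b"
  using assms by (simp add: L2_signals_def square_integrable_sum borel_measurable_sum)

lemma L2_signals_diff:
  assumes f: "f \<in> L2_signals a b" and g: "g \<in> L2_signals a b"
  shows "(\<lambda>t. f t - g t) \<in> L2_signals a b"
proof -
  have "(\<lambda>t. (- mat 1) ** g t) \<in> L2_signals a b"
    by (rule L2_signals_mult[OF g])
  \<comment> \<open>The difference becomes a sum over a two-element index set, so that closure under
    sums and products applies.\<close>
  then have "(\<lambda>t. \<Sum>l\<in>{True, False}. (if l then f else (\<lambda>t. (- mat 1) ** g t)) t) \<in> L2_signals a b"
    using f by (intro L2_signals_sum) simp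
  moreover have "(- mat 1) ** X = - X" for X :: "complex^'a^'a"
    using matrix_mult_diff_left[of 0 "mat 1" X] by simp
  ultimately show ?thesis
    by simp
qed

lemma L2_signals_cong_AE:
  assumes f: "f \<in> L2_signals a b" and eq: "AE t in lebesgue_on (einterval a b). g t = f t"
  shows "g \<in> L2_signals a b"
proof -
  let ?M = "lebesgue_on (einterval a b)"
  have meas: "(\<lambda>t. g t $ i $ j) \<in> borel_measurable ?M" for i j
  proof (rule borel_measurable_lebesgue_on_AE)
    show "(\<lambda>t. f t $ i $ j) \<in> borel_measurable ?M"
      using f by (simp add: L2_signals_def)
    show "AE t in ?M. f t $ i $ j = g t $ i $ j"
      using eq by eventually_elim simp
  qed simp
  moreover have "integrable ?M (\<lambda>t. (cmod (g t $ i $ j))\<^sup>2)" for i j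
  proof (rule integrable_cong_AE_imp)
    show "integrable ?M (\<lambda>t. (cmod (f t $ i $ j))\<^sup>2)"
      using f by (simp add: L2_signals_def)
    show "(\<lambda>t. (cmod (g t $ i $ j))\<^sup>2) \<in> borel_measurable ?M"
      using meas by measurable
    show "AE t in ?M. (cmod (f t $ i $ j))\<^sup>2 = (cmod (g t $ i $ j))\<^sup>2"
      using eq by eventually_elim simp
  qed
  ultimately show ?thesis
    by (simp add: L2_signals_def)
qed

section \<open>The matrix-valued inner product as one Bochner integral\<close>

lemma integrable_vec:
  fixes f :: "'a \<Rightarrow> 'b::euclidean_space^'n"
  assumes "\<And>i. integrable M (\<lambda>x. f x $ i)"
  shows "integrable M f"
proof -
  have "bounded_linear (\<lambda>z :: 'b. axis i z)" for i :: 'n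
    by (simp add: axis_def vec_eq_iff linear_iff flip: linear_conv_bounded_linear)
  then have "integrable M (\<lambda>x. axis i (f x $ i))" for i
    using assms by (rule integrable_bounded_linear)
  then have "integrable M (\<lambda>x. \<Sum>i\<in>UNIV. axis i (f x $ i))"
    by (rule Bochner_Integration.integrable_sum)
  moreover have "(\<Sum>i\<in>UNIV. axis i (v $ i)) = v" for v :: "'b^'n"
    by (simp add: vec_eq_iff axis_def)
  ultimately show ?thesis
    by simp
qed

text \<open>The entrywise integrals in \<open>mat_inner\<close> are the entries of a single
  matrix-valued integral. The algebraic rules for \<open>mat_inner\<close> below then come from
  exchanging that integral with linear maps.\<close>

lemma
  assumes f: "f \<in> L2_signals a b" and g: "g \<in> L2_signals a b"
  shows integrable_mult_dagger:
      "integrable (lebesgue_on (einterval a b)) (\<lambda>t. f t ** dagger (g t))" (is ?int)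
    and mat_inner_eq_integral:
      "mat_inner a b f g = integral\<^sup>L (lebesgue_on (einterval a b)) (\<lambda>t. f t ** dagger (g t))"
proof -
  let ?M = "lebesgue_on (einterval a b)"
  have "integrable ?M (\<lambda>t. f t $ i $ k * cnj (g t $ j $ k))" for i j k
    using f g by (intro integrable_mult_of_square_integrable)
      (auto simp: L2_signals_def intro: borel_measurable_continuous_on[OF continuous_on_cnj[OF continuous_on_id]])
  then have "integrable ?M (\<lambda>t. (f t ** dagger (g t)) $ i $ j)" for i j
    by (simp add: matrix_matrix_mult_def dagger_def)
  then show int: ?int
    by (intro integrable_vec)
  have "bounded_linear (\<lambda>A :: complex^'a^'a. A $ i $ j)" for i j
    by (intro bounded_linear_compose[OF bounded_linear_vec_nth] bounded_linear_vec_nth)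
  then have "integral\<^sup>L ?M (\<lambda>t. (f t ** dagger (g t)) $ i $ j)
      = integral\<^sup>L ?M (\<lambda>t. f t ** dagger (g t)) $ i $ j" for i j
    using int by (rule integral_bounded_linear)
  then show "mat_inner a b f g = integral\<^sup>L ?M (\<lambda>t. f t ** dagger (g t))"
    by (simp add: mat_inner_def vec_eq_iff)
qed

lemma mat_inner_cong_AE:
  assumes f: "f \<in> L2_signals a b" "AE t in lebesgue_on (einterval a b). f' t = f t"
    and g: "g \<in> L2_signals a b" "AE t in lebesgue_on (einterval a b). g' t = g t"
  shows "mat_inner a b f' g' = mat_inner a b f g"
proof -
  note fg' = L2_signals_cong_AE[OF f] L2_signals_cong_AE[OF g]
  have "AE t in lebesgue_on (einterval a b). f' t ** dagger (g' t) = f t ** dagger (g t)"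
    using f(2) g(2) by eventually_elim simp
  then show ?thesis
    using integrable_mult_dagger[OF f(1) g(1)] integrable_mult_dagger[OF fg']
    unfolding mat_inner_eq_integral[OF f(1) g(1)] mat_inner_eq_integral[OF fg']
    by (intro integral_cong_AE borel_measurable_integrable)
qed

lemma dagger_mat_inner:
  assumes "f \<in> L2_signals a b" "g \<in> L2_signals a b"
  shows "dagger (mat_inner a b f g) = mat_inner a b g f"
  using integral_bounded_linear[OF bounded_linear_dagger integrable_mult_dagger[OF assms]]
  unfolding mat_inner_eq_integral[OF assms] mat_inner_eq_integral[OF assms(2,1)]
  by (simp only: dagger_mult dagger_dagger)

lemma mat_inner_mult_left:
  assumes "f \<in> L2_signals a b" "g \<in> L2_signals a b"
  shows "mat_inner a b (\<lambda>t. A ** f t) g = A ** mat_inner a b f g"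
proof -
  let ?M = "lebesgue_on (einterval a b)"
  have "integral\<^sup>L ?M (\<lambda>t. A ** (f t ** dagger (g t))) = A ** integral\<^sup>L ?M (\<lambda>t. f t ** dagger (g t))"
    by (rule integral_bounded_linear[OF bounded_linear_matrix_mult_left integrable_mult_dagger[OF assms]])
  then show ?thesis
    unfolding mat_inner_eq_integral[OF assms]
      mat_inner_eq_integral[OF L2_signals_mult[OF assms(1)] assms(2)]
    by (simp only: matrix_mul_assoc)
qed

lemma mat_inner_mult_right:
  assumes "f \<in> L2_signals a b" "g \<in> L2_signals a b"
  shows "mat_inner a b f (\<lambda>t. A ** g t) = mat_inner a b f g ** dagger A"
proof -
  have "mat_inner a b f (\<lambda>t. A ** g t) = dagger (mat_inner a b (\<lambda>t. A ** g t) f)"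
    by (rule dagger_mat_inner[symmetric]) (intro L2_signals_mult assms)+
  then show ?thesis
    unfolding mat_inner_mult_left[OF assms(2,1)] dagger_mult dagger_mat_inner[OF assms(2,1)] .
qed

lemma mat_inner_diff_left:
  assumes "f \<in> L2_signals a b" "g \<in> L2_signals a b" "h \<in> L2_signals a b"
  shows "mat_inner a b (\<lambda>t. f t - g t) h = mat_inner a b f h - mat_inner a b g h"
  unfolding mat_inner_eq_integral[OF L2_signals_diff[OF assms(1,2)] assms(3)]
    mat_inner_eq_integral[OF assms(1,3)] mat_inner_eq_integral[OF assms(2,3)] matrix_mult_diff_left
  by (intro Bochner_Integration.integral_diff integrable_mult_dagger assms)

lemma mat_inner_sum_left:
  assumes "\<And>l. l \<in> I \<Longrightarrow> f l \<in> L2_signals a b" "h \<in> L2_signals a b"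
  shows "mat_inner a b (\<lambda>t. \<Sum>l\<in>I. f l t) h = (\<Sum>l\<in>I. mat_inner a b (f l) h)"
proof -
  let ?M = "lebesgue_on (einterval a b)"
  have sum: "(\<lambda>t. \<Sum>l\<in>I. f l t) \<in> L2_signals a b"
    using assms(1) by (rule L2_signals_sum)
  have "mat_inner a b (\<lambda>t. \<Sum>l\<in>I. f l t) h = integral\<^sup>L ?M (\<lambda>t. \<Sum>l\<in>I. f l t ** dagger (h t))"
    unfolding mat_inner_eq_integral[OF sum assms(2)] matrix_mult_sum_left ..
  also have "\<dots> = (\<Sum>l\<in>I. integral\<^sup>L ?M (\<lambda>t. f l t ** dagger (h t)))"
    by (intro Bochner_Integration.integral_sum integrable_mult_dagger assms)
  also have "\<dots> = (\<Sum>l\<in>I. mat_inner a b (f l) h)"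
    by (intro sum.cong refl mat_inner_eq_integral[symmetric] assms)
  finally show ?thesis .
qed

text \<open>The form \<open>v \<bullet> (?P *v v)\<close> is the integral of the squared norm of
  \<open>dagger (f t) *v v\<close>. If it vanishes, then so does this vector for almost every
  \<open>t\<close>, and integrating \<open>f t ** dagger (f t)\<close> applied to \<open>v\<close>
  gives \<open>?P *v v = 0\<close>, which invertibility excludes for nonzero
  \<open>v\<close>.\<close>

lemma nondegenerate_imp_posdef:
  assumes f: "f \<in> L2_signals a b" and nondeg: "\<not> degenerate a b f"
  shows "posdef (mat_inner a b f f)"
proof -
  let ?M = "lebesgue_on (einterval a b)"
  let ?P = "mat_inner a b f f"
  note int = integrable_mult_dagger[OF f f]
  have "0 < v \<bullet> (?P *v v)" if "v \<noteq> 0" for v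
  proof -
    have bl: "bounded_linear (\<lambda>A. A *v v)" "bounded_linear (\<lambda>A. v \<bullet> (A *v v))"
      using bounded_linear_matrix_vector_mult[of v]
      by (auto intro: bounded_linear_compose[OF bounded_linear_inner_right])
    have eq: "v \<bullet> ((A ** dagger A) *v v) = (norm (dagger A *v v))\<^sup>2" for A
      by (simp add: power2_norm_eq_inner inner_matrix_vector_left matrix_vector_mul_assoc)
    have int': "integrable ?M (\<lambda>t. (norm (dagger (f t) *v v))\<^sup>2)"
      using integrable_bounded_linear[OF bl(2) int] by (simp add: eq)
    have q: "v \<bullet> (?P *v v) = integral\<^sup>L ?M (\<lambda>t. (norm (dagger (f t) *v v))\<^sup>2)"
      using integral_bounded_linear[OF bl(2) int] by (simp add: eq mat_inner_eq_integral f)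
    have "v \<bullet> (?P *v v) \<noteq> 0"
    proof
      assume "v \<bullet> (?P *v v) = 0"
      then have "AE t in ?M. (norm (dagger (f t) *v v))\<^sup>2 = 0"
        using integral_nonneg_eq_0_iff_AE[OF int'] q by simp
      then have "AE t in ?M. (f t ** dagger (f t)) *v v = 0"
        by eventually_elim (simp flip: matrix_vector_mul_assoc)
      then have "integral\<^sup>L ?M (\<lambda>t. (f t ** dagger (f t)) *v v) = 0"
        by (rule integral_eq_zero_AE)
      then have "?P *v v = 0"
        using integral_bounded_linear[OF bl(1) int] by (simp add: mat_inner_eq_integral f)
      moreover have "invertible ?P"
        using nondeg by (simp add: degenerate_iff_singular)
      ultimately show False
        using that by (metis invertible_left_inverse matrix_left_invertible_ker)
    qed
    then show ?thesis
      unfolding q by (simp add: order_less_le)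
  qed
  then show ?thesis
    using f by (simp add: posdef_iff dagger_mat_inner)
qed

section \<open>Gram-Schmidt orthonormalisation\<close>

text \<open>If the combination were degenerate, independence would put the null space of its Gram
  matrix inside that of \<open>dagger (mat 1)\<close>, which is zero. The Gram matrix would then be
  invertible after all.\<close>

lemma lin_indep_unit_coeff_nondegenerate:
  assumes "lin_indep_signals a b K f" "k \<in> {1..K}" "F k = mat 1"
  shows "\<not> degenerate a b (\<lambda>t. \<Sum>l = 1..K. F l ** f l t)"
proof
  let ?h = "\<lambda>t. \<Sum>l = 1..K. F l ** f l t"
  assume deg: "degenerate a b ?h"
  have "null_space (mat_inner a b ?h ?h) \<subseteq> null_space (dagger (F k))"
    using spec[OF assms(1)[unfolded lin_indep_signals_def Let_def], of F] deg assms(2) by (rule mp[THEN bspec])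
  moreover have "null_space (dagger (F k)) = {0}"
    by (simp add: null_space_def assms(3))
  ultimately have "\<forall>v. mat_inner a b ?h ?h *v v = 0 \<longrightarrow> v = 0"
    unfolding null_space_def by blast
  then have "invertible (mat_inner a b ?h ?h)"
    by (simp only: invertible_left_inverse matrix_left_invertible_ker)
  with deg show False
    by (simp add: degenerate_iff_singular)
qed

theorem proposition8:
  fixes a b :: ereal
    and K :: nat
    and f g g_hat :: "nat \<Rightarrow> real \<Rightarrow> complex^'n^'n"
  assumes "K \<ge> 1"
    and "a < b"
    and "\<And>k. k \<in> {1..K} \<Longrightarrow> f k \<in> L2_signals a b"
    and "lin_indep_signals a b K f"
    and "AE t in lebesgue_on (einterval a b).
           g 1 t = inv_sqrt (mat_inner a b (f 1) (f 1)) ** f 1 t"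
    and "\<And>k. k \<in> {2..K} \<Longrightarrow> AE t in lebesgue_on (einterval a b).
           g_hat k t = f k t - (\<Sum>l = 1..k-1. mat_inner a b (f k) (g l) ** g l t)"
    and "\<And>k. k \<in> {2..K} \<Longrightarrow> AE t in lebesgue_on (einterval a b).
           g k t = inv_sqrt (mat_inner a b (g_hat k) (g_hat k)) ** g_hat k t"
  shows "orthonormal_signals a b K g"
proof -
  let ?M = "lebesgue_on (einterval a b)"
  \<comment> \<open>With \<open>f 1\<close> in the place of \<open>g_hat 1\<close>, the case
    \<open>k = 1\<close> obeys the general recursion, because its sum ranges over the empty set
    \<open>{1..0}\<close>.\<close>
  define G where "G k = (if k = 1 then f 1 else g_hat k)" for k
  define r where "r k l = mat_inner a b (f k) (g l)" for k l
  have G: "AE t in ?M. G k t = f k t - (\<Sum>l = 1..k-1. r k l ** g l t)"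
    and gG: "AE t in ?M. g k t = inv_sqrt (mat_inner a b (G k) (G k)) ** G k t"
    if "k \<in> {1..K}" for k
  proof -
    have "(AE t in ?M. G k t = f k t - (\<Sum>l = 1..k-1. r k l ** g l t)) \<and>
        (AE t in ?M. g k t = inv_sqrt (mat_inner a b (G k) (G k)) ** G k t)"
    proof (cases "k = 1")
      case True
      then show ?thesis
        using assms(5) by (simp add: G_def)
    next
      case False
      then have "k \<in> {2..K}"
        using that by auto
      from assms(6)[OF this] assms(7)[OF this] False show ?thesis
        by (simp only: G_def r_def if_False simp_thms)
    qed
    then show "AE t in ?M. G k t = f k t - (\<Sum>l = 1..k-1. r k l ** g l t)"
      "AE t in ?M. g k t = inv_sqrt (mat_inner a b (G k) (G k)) ** G k t"
      by blast+
  qed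
  define \<delta> :: "nat \<Rightarrow> nat \<Rightarrow> complex^'n^'n" where "\<delta> k l = (if k = l then mat 1 else 0)" for k l
  \<comment> \<open>All expansions use the full range \<open>1..K\<close>, as in
    \<open>lin_indep_signals\<close>. The vanishing of \<open>F j\<close> for \<open>j > k\<close>
    is what later isolates the coefficient of the newest signal.\<close>
  have step: "g k \<in> L2_signals a b
      \<and> (\<exists>F. (AE t in ?M. g k t = (\<Sum>j = 1..K. F j ** f j t)) \<and> (\<forall>j>k. F j = 0))
      \<and> (\<forall>l\<in>{1..k}. mat_inner a b (g k) (g l) = \<delta> k l)"
    if "k \<in> {1..K}" for k
    using that
  proof (induction k rule: less_induct)
    case (less k)
    have L2g: "g l \<in> L2_signals a b" if "l \<in> {1..k-1}" for l
      using less.IH[of l] less.prems that by auto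
    have ortho_le: "mat_inner a b (g l) (g m) = \<delta> l m" if "l \<in> {1..k-1}" "m \<in> {1..l}" for l m
      using less.IH[of l] less.prems that by auto
    \<comment> \<open>The induction hypothesis covers only \<open>m \<le> l\<close>; the other pairs
      follow by conjugate symmetry.\<close>
    have ortho: "mat_inner a b (g l) (g m) = \<delta> l m" if "l \<in> {1..k-1}" "m \<in> {1..k-1}" for l m
    proof (cases "m \<le> l")
      case False
      have "mat_inner a b (g l) (g m) = dagger (mat_inner a b (g m) (g l))"
        using that by (simp add: L2g dagger_mat_inner)
      also have "\<dots> = \<delta> l m"
        using False that ortho_le[of m l] by (simp add: \<delta>_def) (simp add: dagger_def vec_eq_iff)
      finally show ?thesis .
    qed (use that ortho_le in auto)
    have "\<forall>l\<in>{1..k-1}. \<exists>F. (AE t in ?M. g l t = (\<Sum>j = 1..K. F j ** f j t)) \<and> (\<forall>j>l. F j = 0)"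
      using less.IH less.prems by auto
    from bchoice[OF this] obtain C where C: "\<And>l. l \<in> {1..k-1} \<Longrightarrow> AE t in ?M. g l t = (\<Sum>j = 1..K. C l j ** f j t)"
      and C0: "\<And>l j. l \<in> {1..k-1} \<Longrightarrow> j > l \<Longrightarrow> C l j = 0"
      by blast
    \<comment> \<open>These are the coefficients of \<open>G k\<close> after the expansions of the
      earlier \<open>g l\<close> are substituted. At \<open>j = k\<close> the sum vanishes, as each
      \<open>C l k\<close> with \<open>l < k\<close> is zero, so \<open>D k = mat 1\<close>.\<close>
    define D where "D j = \<delta> k j - (\<Sum>l = 1..k-1. r k l ** C l j)" for j
    have "(\<Sum>l = 1..k-1. r k l ** C l j) = 0" if "j \<ge> k" for j
    proof (rule sum.neutral, rule ballI)
      fix l assume "l \<in> {1..k-1}"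
      moreover from this that have "j > l"
        by auto
      ultimately show "r k l ** C l j = 0"
        using C0 by simp
    qed
    then have D: "D k = mat 1" "\<And>j. j > k \<Longrightarrow> D j = 0"
      unfolding D_def \<delta>_def by auto
    \<comment> \<open>Independence speaks of literal combinations, whereas \<open>G k\<close> is one
      only almost everywhere. So nondegeneracy is shown for \<open>h\<close> and then transferred to
      \<open>G k\<close>.\<close>
    define h where "h t = (\<Sum>j = 1..K. D j ** f j t)" for t
    have h: "h \<in> L2_signals a b"
      unfolding h_def using assms(3) by (intro L2_signals_sum L2_signals_mult)
    \<comment> \<open>Finitely many exceptional null sets are merged, so that all expansions can be
      substituted at the same \<open>t\<close>.\<close>
    have "AE t in ?M. \<forall>l\<in>{1..k-1}. g l t = (\<Sum>j = 1..K. C l j ** f j t)"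
      using C by (intro AE_finite_allI) auto
    with G[OF less.prems] have Gh: "AE t in ?M. G k t = h t"
    proof eventually_elim
      case (elim t)
      have "(\<Sum>l = 1..k-1. r k l ** g l t)
          = (\<Sum>l = 1..k-1. \<Sum>j = 1..K. r k l ** C l j ** f j t)"
        using elim(2) by (simp add: matrix_mult_sum_right matrix_mul_assoc)
      also have "\<dots> = (\<Sum>j = 1..K. (\<Sum>l = 1..k-1. r k l ** C l j) ** f j t)"
        by (subst sum.swap) (simp add: matrix_mult_sum_left)
      finally have "G k t = f k t - (\<Sum>j = 1..K. (\<Sum>l = 1..k-1. r k l ** C l j) ** f j t)"
        using elim(1) by simp
      moreover have "(\<Sum>j = 1..K. \<delta> k j ** f j t) = f k t"
      proof -
        have "(\<Sum>j = 1..K. \<delta> k j ** f j t) = (\<Sum>j = 1..K. if k = j then f j t else 0)"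
          by (intro sum.cong) (auto simp: \<delta>_def)
        then show ?thesis
          using less.prems by simp
      qed
      ultimately show ?case
        by (simp add: h_def D_def matrix_mult_diff_left sum_subtractf)
    qed
    have GL2: "G k \<in> L2_signals a b"
      by (rule L2_signals_cong_AE[OF h Gh])
    define Q where "Q = inv_sqrt (mat_inner a b (G k) (G k))"
    have "\<not> degenerate a b h"
      unfolding h_def using assms(4) less.prems D(1) by (rule lin_indep_unit_coeff_nondegenerate)
    then have "posdef (mat_inner a b (G k) (G k))"
      using nondegenerate_imp_posdef[OF h] mat_inner_cong_AE[OF h Gh h Gh] by simp
    then have Q: "Q ** mat_inner a b (G k) (G k) ** dagger Q = mat 1"
      unfolding Q_def by (rule inv_sqrt_posdef)
    have QG: "(\<lambda>t. Q ** G k t) \<in> L2_signals a b"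
      by (rule L2_signals_mult[OF GL2])
    have gk: "AE t in ?M. g k t = Q ** G k t"
      unfolding Q_def by (rule gG[OF less.prems])
    have gkL2: "g k \<in> L2_signals a b"
      by (rule L2_signals_cong_AE[OF QG gk])
    have "mat_inner a b (g k) (g l) = \<delta> k l" if l: "l \<in> {1..k}" for l
    proof (cases "l = k")
      case True
      then show ?thesis
        using Q by (simp add: mat_inner_cong_AE[OF QG gk QG gk] mat_inner_mult_left
            mat_inner_mult_right GL2 QG \<delta>_def matrix_mul_assoc)
    next
      case False
      then have l: "l \<in> {1..k-1}"
        using that by auto
      let ?p = "\<lambda>t. f k t - (\<Sum>m = 1..k-1. r k m ** g m t)"
      have fk: "f k \<in> L2_signals a b" and s: "(\<lambda>t. \<Sum>m = 1..k-1. r k m ** g m t) \<in> L2_signals a b"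
        using assms(3) less.prems L2g by (auto intro!: L2_signals_sum L2_signals_mult)
      have "mat_inner a b (G k) (g l) = mat_inner a b ?p (g l)"
        using L2_signals_diff[OF fk s] G[OF less.prems] L2g[OF l]
        by (rule mat_inner_cong_AE) simp
      also have "\<dots> = r k l - (\<Sum>m = 1..k-1. r k m ** mat_inner a b (g m) (g l))"
      proof -
        have "mat_inner a b (\<lambda>t. \<Sum>m = 1..k-1. r k m ** g m t) (g l)
            = (\<Sum>m = 1..k-1. mat_inner a b (\<lambda>t. r k m ** g m t) (g l))"
          by (intro mat_inner_sum_left L2_signals_mult L2g l)
        also have "\<dots> = (\<Sum>m = 1..k-1. r k m ** mat_inner a b (g m) (g l))"
          by (intro sum.cong refl mat_inner_mult_left L2g l)
        finally have sum: "mat_inner a b (\<lambda>t. \<Sum>m = 1..k-1. r k m ** g m t) (g l)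
            = (\<Sum>m = 1..k-1. r k m ** mat_inner a b (g m) (g l))" .
        show ?thesis
          unfolding mat_inner_diff_left[OF fk s L2g[OF l]] sum by (simp only: r_def)
      qed
      \<comment> \<open>Orthonormality of the earlier signals leaves only \<open>m = l\<close>, and
        this term cancels \<open>r k l\<close>.\<close>
      also have "(\<Sum>m = 1..k-1. r k m ** mat_inner a b (g m) (g l))
          = (\<Sum>m = 1..k-1. if m = l then r k m else 0)"
        using l by (intro sum.cong) (auto simp: ortho \<delta>_def)
      also have "\<dots> = r k l"
        using l by simp
      finally have "mat_inner a b (G k) (g l) = 0"
        by simp
      moreover have "mat_inner a b (g k) (g l) = Q ** mat_inner a b (G k) (g l)"
        using mat_inner_cong_AE[OF QG gk L2g[OF l]] by (simp add: mat_inner_mult_left GL2 L2g[OF l])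
      ultimately show ?thesis
        using False by (simp add: \<delta>_def)
    qed
    moreover have "AE t in ?M. g k t = (\<Sum>j = 1..K. (Q ** D j) ** f j t)"
      using gk Gh
      by eventually_elim (simp add: h_def matrix_mult_sum_right matrix_mul_assoc)
    moreover have "\<forall>j>k. Q ** D j = 0"
      by (simp add: D(2))
    ultimately show ?case
      using gkL2 by (intro conjI exI[of _ "\<lambda>j. Q ** D j"]) auto
  qed
  \<comment> \<open>\<open>step\<close> gives the pairs with \<open>l \<le> k\<close>; conjugate
    symmetry gives the rest.\<close>
  have "mat_inner a b (g k) (g l) = \<delta> k l" if "k \<in> {1..K}" "l \<in> {1..K}" for k l
  proof (cases "l \<le> k")
    case False
    have "mat_inner a b (g k) (g l) = dagger (mat_inner a b (g l) (g k))"
      using that step by (simp add: dagger_mat_inner)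
    also have "\<dots> = \<delta> k l"
      using False that step[of l] by (simp add: \<delta>_def) (simp add: dagger_def vec_eq_iff)
    finally show ?thesis .
  qed (use that step[of k] in auto)
  then show ?thesis
    by (simp add: orthonormal_signals_def \<delta>_def)
qed

end
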